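(* Let $X$ be a separable Banach space. Then its closed unit ball $B_X$ is a slicely countably determined (SCD) set if and only if $\operatorname{bc}(X^* )=1$.
   Context: All Banach spaces are real. $B_X$, $S_X$ denote the closed unit ball and the unit sphere of $X$; $B(x,r)$ is the open ball with center $x$ and radius $r>0$. A slice of a bounded convex set $A\subset X$ is a non-empty intersection of $A$ with an open half-space; equivalently a set $\{x\in A: f(x)>\sup f(A)-\delta\}$ with $f\in X^*$, $\delta>0$. A bounded convex set $A\subset X$ is a slicely countably determined (SCD) set if there is a sequence $(S_n)_{n\in\mathbb N}$ of slices of $A$ such that $A\subseteq\overline{\operatorname{conv}}\{b_n:n\in\mathbb N\}$ for every sequence $(b_n)$ with $b_n\in S_n$ for all $n$. For $\alpha\in[-1,1)$, a Banach space $Z$ has the $\alpha$-BCP (strictly $\alpha$-off ball-covering property) if there is a countable collection of open balls $\{B(z_n,r_n)\}$, $r_n>0$, with $S_Z\subset\bigcup_n B(z_n,r_n)$ and $\|z_n\|\ge r_n+\alpha$ for all $n$. The ball-covering index is $\operatorname{bc}(Z):=\sup\{\alpha\in[-1,1): Z\text{ has the }\alpha\text{-BCP}\}$, with the convention that it equals $-1$ if this set is empty. *)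

theory Defs
  imports "HOL-Analysis.Analysis"
begin

(* The dual space is the type of bounded linear functionals 'a =>_L real with the operator
   norm.  Taking f = 0 yields A itself, as with any nonzero f and large delta; in the zero
   space A has no other slice.  The supremum is meaningful since A is bounded wherever this
   is used. *)
definition slice_of :: "'a::real_normed_vector set \<Rightarrow> 'a set \<Rightarrow> bool" where
  "slice_of A S \<longleftrightarrow> S \<noteq> {} \<and>
     (\<exists>(f :: 'a \<Rightarrow>\<^sub>L real) \<delta>. \<delta> > 0 \<and>
        S = {x \<in> A. blinfun_apply f x > (SUP y\<in>A. blinfun_apply f y) - \<delta>})"

lemma slice_of_iff_halfspace:
  fixes A :: "'a::real_normed_vector set"
  assumes "bounded A"
  shows "slice_of A S \<longleftrightarrow>
    S \<noteq> {} \<and> (\<exists>(f :: 'a \<Rightarrow>\<^sub>L real) a. S = {x \<in> A. blinfun_apply f x > a})"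
proof (intro iffI conjI)
  assume *: "S \<noteq> {} \<and> (\<exists>(f :: 'a \<Rightarrow>\<^sub>L real) a. S = {x \<in> A. blinfun_apply f x > a})"
  then obtain f :: "'a \<Rightarrow>\<^sub>L real" and a
    where S: "S = {x \<in> A. blinfun_apply f x > a}" by blast
  define s where "s = (SUP y\<in>A. blinfun_apply f y)"
  obtain x where x: "x \<in> A" "blinfun_apply f x > a" using * S by blast
  have "bounded (blinfun_apply f ` A)"
    using assms blinfun.bounded_linear_right bounded_linear_image by blast
  then have "bdd_above (blinfun_apply f ` A)" by (rule bounded_imp_bdd_above)
  then have "blinfun_apply f x \<le> s" unfolding s_def by (intro cSUP_upper x(1))
  then have "s - a > 0" "S = {x \<in> A. blinfun_apply f x > s - (s - a)}"
    using x S by auto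
  then show "slice_of A S" using * unfolding slice_of_def s_def by blast
qed (auto simp: slice_of_def)

definition scd_set :: "'a::real_normed_vector set \<Rightarrow> bool" where
  "scd_set A \<longleftrightarrow> bounded A \<and> convex A \<and>
     (\<exists>S :: nat \<Rightarrow> 'a set. (\<forall>n. slice_of A (S n)) \<and>
        (\<forall>b. (\<forall>n. b n \<in> S n) \<longrightarrow> A \<subseteq> closure (convex hull (range b))))"

(* A collection of balls is a set of (center, radius) pairs.  It may be empty, which matters
   only for the zero space, whose unit sphere is empty. *)
definition alpha_bcp :: "'z::banach itself \<Rightarrow> real \<Rightarrow> bool" where
  "alpha_bcp _ \<alpha> \<longleftrightarrow>
     (\<exists>C :: ('z \<times> real) set. countable C \<and>
        (\<forall>(z, r) \<in> C. r > 0 \<and> norm z \<ge> r + \<alpha>) \<and>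
        sphere 0 1 \<subseteq> (\<Union>(z, r) \<in> C. ball z r))"

definition ball_covering_index :: "'z::banach itself \<Rightarrow> real" where
  "ball_covering_index Z =
     (if {\<alpha> \<in> {-1..<1}. alpha_bcp Z \<alpha>} = {} then - 1
      else Sup {\<alpha> \<in> {-1..<1}. alpha_bcp Z \<alpha>})"

end

theory Submission
  imports Defs
begin

text \<open>A sequence of slices determines the ball iff every slice of the ball contains one of them, by
  Hahn--Banach. If the slice of width \<open>\<delta>\<close> given by \<open>g\<close> lies in the slice \<open>{f > \<beta>}\<close>, where
  \<open>\<parallel>f\<parallel> = 1\<close>, then \<open>f\<close> has distance at most \<open>\<parallel>t g\<parallel> - \<beta>\<close> from \<open>t g\<close> for \<open>t = 2 / \<delta>\<close>, so that countably
  many balls with centers \<open>t g\<close> cover the dual sphere. Conversely, if \<open>f\<close> lies in a ball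
  with center \<open>z\<close> and radius at most \<open>\<parallel>z\<parallel> - \<alpha>\<close>, then \<open>f > \<alpha> - \<epsilon>\<close> on the slice of width \<open>\<epsilon>\<close> given by \<open>z\<close>;
  taking \<open>\<alpha> \<rightarrow> 1\<close> and \<open>\<epsilon> \<rightarrow> 0\<close>, the centers provide determining slices.\<close>

section \<open>Hahn--Banach separation\<close>

definition sublinear :: "('a::real_vector \<Rightarrow> real) \<Rightarrow> bool" where
  "sublinear p \<longleftrightarrow> (\<forall>x y. p (x + y) \<le> p x + p y) \<and> (\<forall>t\<ge>0. \<forall>x. p (t *\<^sub>R x) = t * p x)"

lemma sublinear_add: "sublinear p \<Longrightarrow> p (x + y) \<le> p x + p y"
  and sublinear_scaleR: "sublinear p \<Longrightarrow> 0 \<le> t \<Longrightarrow> p (t *\<^sub>R x) = t * p x"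
  by (auto simp: sublinear_def)

lemma sublinear_zero: "sublinear p \<Longrightarrow> p 0 = 0"
  using sublinear_scaleR[of p 0 0] by simp

lemma sublinear_minus: "sublinear p \<Longrightarrow> - p (- x) \<le> p x"
  using sublinear_add[of p x "- x"] by (simp add: sublinear_zero)

lemma sublinear_norm: "sublinear norm"
  by (simp add: sublinear_def norm_triangle_ineq)

text \<open>Homogeneity needs only one inequality: the same bound for \<open>inverse t\<close> at
  \<open>t *\<^sub>R x\<close> is the reverse one.\<close>

lemma sublinearI:
  assumes "\<And>x y. p (x + y) \<le> p x + p y" and le: "\<And>t x. 0 < t \<Longrightarrow> p (t *\<^sub>R x) \<le> t * p x"
    and "p 0 = 0"
  shows "sublinear p"
  unfolding sublinear_def
proof (intro conjI allI impI)
  fix t :: real and x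
  assume "0 \<le> t"
  show "p (t *\<^sub>R x) = t * p x"
  proof (cases "t = 0")
    case False
    then have t: "0 < t" using \<open>0 \<le> t\<close> by simp
    have "p x \<le> inverse t * p (t *\<^sub>R x)"
      using le[of "inverse t" "t *\<^sub>R x"] t by simp
    then have "t * p x \<le> p (t *\<^sub>R x)"
      using t by (simp add: field_simps)
    with le[OF t, of x] show ?thesis by simp
  qed (simp add: assms)
qed (rule assms(1))

text \<open>Taking \<open>C = {y}\<close> and \<open>c = p y\<close> shows that a minimal sublinear functional is odd, hence linear;
  taking \<open>C = x - K\<close>, \<open>p\<close> the norm and \<open>c\<close> the distance of \<open>x\<close> from \<open>K\<close> separates \<open>x\<close> from \<open>K\<close>.\<close>

lemma sublinear_refine:
  fixes p :: "'a::real_vector \<Rightarrow> real"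
  assumes p: "sublinear p" and C: "convex C" "C \<noteq> {}" and c: "\<And>w. w \<in> C \<Longrightarrow> c \<le> p w"
  obtains q where "sublinear q" "\<And>x. q x \<le> p x" "\<And>w. w \<in> C \<Longrightarrow> q (- w) \<le> - c"
proof -
  \<comment> \<open>Any sublinear \<open>r\<close> below \<open>p\<close> with
    \<open>r (- w) \<le> - c\<close> on \<open>C\<close> satisfies
    \<open>r v \<le> p (v + t *\<^sub>R w) - t * c\<close>. The infimum of these bounds is thus the
    largest candidate.\<close>
  define h where "h v = (\<lambda>(t, w). p (v + t *\<^sub>R w) - t * c)" for v
  define q where "q v = Inf (h v ` ({0..} \<times> C))" for v
  \<comment> \<open>A bound independent of \<open>t\<close> and \<open>w\<close>, so the infimum is
    finite.\<close>
  have lower: "- p (- v) \<le> h v (t, w)" if "0 \<le> t" "w \<in> C" for v t w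
  proof -
    have "t * c \<le> p (t *\<^sub>R w)"
      using that c p by (simp add: sublinear_scaleR mult_left_mono)
    also have "\<dots> \<le> p (v + t *\<^sub>R w) + p (- v)"
      using sublinear_add[OF p, of "v + t *\<^sub>R w" "- v"] by simp
    finally show ?thesis by (simp add: h_def)
  qed
  have ub: "q v \<le> h v (t, w)" if "0 \<le> t" "w \<in> C" for v t w
    unfolding q_def using that lower by (intro cINF_lower bdd_belowI2[where m = "- p (- v)"]) auto
  have lb: "m \<le> q v" if "\<And>t w. 0 \<le> t \<Longrightarrow> w \<in> C \<Longrightarrow> m \<le> h v (t, w)" for m v
    unfolding q_def using that C by (intro cINF_greatest) auto
  obtain w0 where w0: "w0 \<in> C" using C by blast
  have le: "q v \<le> p v" for v
    using ub[of 0 w0 v] w0 by (simp add: h_def)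
  show thesis
  proof
    show "q v \<le> p v" for v by (rule le)
    show "q (- w) \<le> - c" if "w \<in> C" for w
      using ub[of 1 w "- w"] that p by (simp add: h_def sublinear_zero)
    show "sublinear q"
    proof (rule sublinearI)
      fix x y
      have "q (x + y) \<le> h x (s, u) + h y (t, w)"
        if "0 \<le> s" "u \<in> C" "0 \<le> t" "w \<in> C" for s u t w
      proof (cases "s + t = 0")
        case True
        then have "s = 0" "t = 0" using that by auto
        then show ?thesis
          using le[of "x + y"] sublinear_add[OF p, of x y] by (simp add: h_def)
      next
        case False
        then have pos: "0 < s + t" using that by simp
        \<comment> \<open>The weighted mean lets the single pair \<open>(s + t, k)\<close> replace
          \<open>(s, u)\<close> and \<open>(t, w)\<close>; this is where convexity of
          \<open>C\<close> enters.\<close>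
        define k where "k = (s / (s + t)) *\<^sub>R u + (t / (s + t)) *\<^sub>R w"
        have "k \<in> C"
          unfolding k_def using that pos
          by (intro convexD[OF C(1)]) (auto simp: add_divide_distrib[symmetric])
        then have "q (x + y) \<le> h (x + y) (s + t, k)"
          using pos by (intro ub) auto
        moreover have "(s + t) *\<^sub>R k = s *\<^sub>R u + t *\<^sub>R w"
          using pos by (simp add: k_def scaleR_add_right)
        ultimately show ?thesis
          using sublinear_add[OF p, of "x + s *\<^sub>R u" "y + t *\<^sub>R w"]
          by (simp add: h_def algebra_simps)
      qed
      then have "q (x + y) - h x (s, u) \<le> q y" if "0 \<le> s" "u \<in> C" for s u
        using that by (intro lb) (simp add: algebra_simps)
      then have "q (x + y) - q y \<le> q x"
        by (intro lb) (simp add: algebra_simps)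
      then show "q (x + y) \<le> q x + q y" by simp
    next
      fix t :: real and x
      assume t: "0 < t"
      have "q (t *\<^sub>R x) \<le> t * h x (s, w)" if "0 \<le> s" "w \<in> C" for s w
        using ub[of "t * s" w "t *\<^sub>R x"] that t sublinear_scaleR[OF p, of t "x + s *\<^sub>R w"]
        by (simp add: h_def algebra_simps)
      then have "q (t *\<^sub>R x) / t \<le> q x"
        using t by (intro lb) (simp add: field_simps)
      then show "q (t *\<^sub>R x) \<le> t * q x"
        using t by (simp add: field_simps)
    next
      show "q 0 = 0"
        using le[of 0] lb[of 0 0] lower[of _ _ 0] p by (force simp: sublinear_zero)
    qed
  qed
qed

text \<open>Supplies the lower bounds for Zorn's lemma. Subadditivity survives the infimum because
  the smaller of two members of the chain bounds both terms at once.\<close>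

lemma sublinear_Inf_chain:
  assumes Q: "Q \<noteq> {}" "\<And>q. q \<in> Q \<Longrightarrow> sublinear q"
    and chain: "\<And>q r. q \<in> Q \<Longrightarrow> r \<in> Q \<Longrightarrow> q \<le> r \<or> r \<le> q"
    and bdd: "\<And>q. q \<in> Q \<Longrightarrow> q \<le> p"
  shows "sublinear (\<lambda>x. INF q\<in>Q. q x)" "q \<in> Q \<Longrightarrow> (INF q\<in>Q. q x) \<le> q x"
proof -
  have ub: "(INF q\<in>Q. q x) \<le> q x" if "q \<in> Q" for q x
  proof (rule cINF_lower[OF bdd_belowI2[where m = "- p (- x)"] that])
    fix r assume "r \<in> Q"
    then show "- p (- x) \<le> r x"
      using sublinear_minus[OF Q(2), of r x] bdd[of r] by (auto simp: le_fun_def dest!: spec[of _ "- x"])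
  qed
  then show "q \<in> Q \<Longrightarrow> (INF q\<in>Q. q x) \<le> q x" .
  show "sublinear (\<lambda>x. INF q\<in>Q. q x)"
  proof (rule sublinearI)
    fix x y
    have "(INF q\<in>Q. q (x + y)) \<le> q x + r y" if qr: "q \<in> Q" "r \<in> Q" for q r
    proof -
      obtain m where m: "m \<in> Q" "m \<le> q" "m \<le> r" using chain[OF qr] qr by blast
      have "(INF q\<in>Q. q (x + y)) \<le> m x + m y"
        using ub[OF m(1)] sublinear_add[OF Q(2)[OF m(1)]] by (rule order_trans)
      also have "\<dots> \<le> q x + r y" using m by (intro add_mono) (auto simp: le_fun_def)
      finally show ?thesis .
    qed
    then have "(INF q\<in>Q. q (x + y)) - q x \<le> (INF r\<in>Q. r y)" if "q \<in> Q" for q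
      using that by (intro cINF_greatest[OF Q(1)]) (simp add: diff_le_eq add.commute[of _ "q x"])
    then have "(INF q\<in>Q. q (x + y)) - (INF r\<in>Q. r y) \<le> (INF q\<in>Q. q x)"
      by (intro cINF_greatest[OF Q(1)]) (simp add: algebra_simps)
    then show "(INF q\<in>Q. q (x + y)) \<le> (INF q\<in>Q. q x) + (INF q\<in>Q. q y)" by simp
  next
    fix t :: real and x
    assume t: "0 < t"
    have "(INF q\<in>Q. q (t *\<^sub>R x)) / t \<le> (INF q\<in>Q. q x)"
    proof (rule cINF_greatest[OF Q(1)])
      fix q assume "q \<in> Q"
      then show "(INF q\<in>Q. q (t *\<^sub>R x)) / t \<le> q x"
        using ub[of q "t *\<^sub>R x"] t sublinear_scaleR[OF Q(2), of q t x] by (simp add: field_simps)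
    qed
    then show "(INF q\<in>Q. q (t *\<^sub>R x)) \<le> t * (INF q\<in>Q. q x)"
      using t by (simp add: field_simps)
  next
    have "(\<lambda>q. q 0) ` Q = {0}" using Q sublinear_zero by force
    then show "(INF q\<in>Q. q 0) = 0" by simp
  qed
qed

text \<open>Zorn's lemma gives a minimal sublinear functional below \<open>p\<close>. Refining it at
  a point cannot lower it, which makes it odd, and an odd sublinear functional is linear.\<close>

lemma sublinear_dominates_linear:
  fixes p :: "'a::real_vector \<Rightarrow> real"
  assumes p: "sublinear p"
  obtains f where "linear f" "\<And>x. f x \<le> p x"
proof -
  define P where "P = {q. sublinear q \<and> q \<le> p}"
  \<comment> \<open>The order is reversed, so that maximal elements are minimal functionals.\<close>
  have "\<exists>q\<in>P. \<forall>r\<in>P. r \<le> q \<longrightarrow> r = q"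
  proof (rule predicate_Zorn[of P "\<lambda>q r. r \<le> q"])
    show "partial_order_on P (relation_of (\<lambda>q r. r \<le> q) P)"
      by (auto simp: partial_order_on_def preorder_on_def refl_on_def trans_def antisym_def
          relation_of_def)
    fix Q assume "Q \<in> Chains (relation_of (\<lambda>q r. r \<le> q) P)"
    then have chain: "Q \<subseteq> P" "\<And>q r. q \<in> Q \<Longrightarrow> r \<in> Q \<Longrightarrow> q \<le> r \<or> r \<le> q"
      by (auto simp: Chains_def relation_of_def)
    show "\<exists>u\<in>P. \<forall>q\<in>Q. u \<le> q"
    proof (cases "Q = {}")
      case True
      then show ?thesis using p by (auto simp: P_def)
    next
      case False
      then obtain q where "q \<in> Q" by blast
      have *: "sublinear (\<lambda>x. INF q\<in>Q. q x)" "\<And>q x. q \<in> Q \<Longrightarrow> (INF q\<in>Q. q x) \<le> q x"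
        using sublinear_Inf_chain[of Q p] False chain by (auto simp: P_def)
      moreover have "(\<lambda>x. INF q\<in>Q. q x) \<le> p"
        using *(2)[OF \<open>q \<in> Q\<close>] \<open>q \<in> Q\<close> chain(1) unfolding P_def le_fun_def
        by (blast intro: order_trans)
      ultimately show ?thesis
        by (intro bexI[of _ "\<lambda>x. INF q\<in>Q. q x"]) (auto simp: P_def le_fun_def)
    qed
  qed
  then obtain q where q: "sublinear q" "q \<le> p"
    and min: "\<And>r. sublinear r \<Longrightarrow> r \<le> q \<Longrightarrow> r = q"
    unfolding P_def by (auto intro: order_trans)
  have odd: "q (- y) = - q y" for y
  proof -
    obtain r where "sublinear r" "\<And>x. r x \<le> q x" "r (- y) \<le> - q y"
      using sublinear_refine[OF q(1), of "{y}" "q y"] by auto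
    then have "q (- y) \<le> - q y" using min[of r] by (auto simp: le_fun_def)
    then show ?thesis using sublinear_minus[OF q(1), of y] by simp
  qed
  have "linear q"
  proof (rule linearI)
    show "q (x + y) = q x + q y" for x y
      using sublinear_add[OF q(1), of x y] sublinear_add[OF q(1), of "x + y" "- y"] odd[of y] by simp
    show "q (t *\<^sub>R x) = t *\<^sub>R q x" for t x
      using sublinear_scaleR[OF q(1), of t x] sublinear_scaleR[OF q(1), of "- t" x] odd[of "t *\<^sub>R x"]
      by (cases "0 \<le> t") auto
  qed
  then show thesis using that q(2) by (auto simp: le_fun_def)
qed

lemma separate_point_closed_convex:
  fixes K :: "'a::real_normed_vector set"
  assumes K: "convex K" "closed K" "K \<noteq> {}" and x: "x \<notin> K"
  obtains f :: "'a \<Rightarrow>\<^sub>L real" and d where "0 < d" "\<And>k. k \<in> K \<Longrightarrow> f k \<le> f x - d"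
proof -
  define d where "d = infdist x K"
  have d: "0 < d" unfolding d_def by (rule infdist_pos_not_in_closed[OF K(2,3) x])
  have "d \<le> norm w" if "w \<in> (\<lambda>k. x - k) ` K" for w
    using that infdist_le[of _ K x] by (auto simp: d_def dist_norm)
  moreover have "convex ((\<lambda>k. x - k) ` K)"
    using convex_translation[OF convex_negations[OF K(1)], of x] by (simp add: image_image)
  ultimately obtain q where q: "sublinear q" "\<And>v. q v \<le> norm v"
    "\<And>w. w \<in> (\<lambda>k. x - k) ` K \<Longrightarrow> q (- w) \<le> - d"
    using sublinear_refine[OF sublinear_norm, of "(\<lambda>k. x - k) ` K" d] K(3) by blast
  obtain f where f: "linear f" "\<And>v. f v \<le> q v"
    using sublinear_dominates_linear[OF q(1)] by blast
  \<comment> \<open>Domination by the norm at both \<open>v\<close> and \<open>- v\<close> makes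
    \<open>f\<close> continuous.\<close>
  have "\<bar>f v\<bar> \<le> norm v" for v
    using f(2)[of v] f(2)[of "- v"] q(2)[of v] q(2)[of "- v"] linear_neg[OF f(1), of v] by simp
  then have "bounded_linear f"
    using f(1) by (intro bounded_linear_intro[where K = 1]) (auto simp: linear_add linear_scale)
  moreover have "f k \<le> f x - d" if "k \<in> K" for k
    using f(2)[of "k - x"] q(3)[of "x - k"] that by (simp add: linear_diff[OF f(1)])
  ultimately show thesis
    using that[OF d, of "Blinfun f"] by (simp add: bounded_linear_Blinfun_apply)
qed

section \<open>Slices of the unit ball\<close>

lemma blinfun_le_norm:
  fixes f :: "'a::real_normed_vector \<Rightarrow>\<^sub>L real"
  assumes "x \<in> cball 0 1"
  shows "f x \<le> norm f"
proof -
  have "f x \<le> norm f * norm x" using norm_blinfun[of f x] by simp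
  also have "\<dots> \<le> norm f" using assms by (intro mult_left_le) auto
  finally show ?thesis .
qed

text \<open>The ball is symmetric, so a one-sided bound already controls the absolute value.\<close>

lemma norm_blinfun_le_cball:
  fixes f :: "'a::real_normed_vector \<Rightarrow>\<^sub>L real"
  assumes s: "\<And>x. x \<in> cball 0 1 \<Longrightarrow> f x \<le> s"
  shows "norm f \<le> s"
proof (rule norm_blinfun_bound)
  show "0 \<le> s" using s[of 0] by simp
  fix x
  show "norm (f x) \<le> s * norm x"
  proof (cases "x = 0")
    case False
    have "f (x /\<^sub>R norm x) \<le> s" "f (- (x /\<^sub>R norm x)) \<le> s"
      using False by (intro s; simp)+
    then show ?thesis
      using False by (auto simp: blinfun.bilinear_simps field_simps abs_le_iff)
  qed simp
qed

lemma SUP_cball_blinfun: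
  fixes f :: "'a::real_normed_vector \<Rightarrow>\<^sub>L real"
  shows "(SUP x\<in>cball 0 1. f x) = norm f"
proof (rule cSup_eq_non_empty)
  show "s \<le> norm f" if "s \<in> blinfun_apply f ` cball 0 1" for s
    using that blinfun_le_norm[of _ f] by blast
  show "norm f \<le> s" if "\<And>y. y \<in> blinfun_apply f ` cball 0 1 \<Longrightarrow> y \<le> s" for s
    using that by (intro norm_blinfun_le_cball) blast
qed simp

text \<open>Non-emptiness is automatic: otherwise \<open>norm f - \<delta>\<close> would bound
  \<open>f\<close> on the ball and hence bound \<open>norm f\<close>.\<close>

lemma slice_of_cball_iff:
  fixes S :: "'a::real_normed_vector set"
  shows "slice_of (cball 0 1) S \<longleftrightarrow>
    (\<exists>(f :: 'a \<Rightarrow>\<^sub>L real) \<delta>. \<delta> > 0 \<and> S = {x \<in> cball 0 1. blinfun_apply f x > norm f - \<delta>})"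
proof -
  have "\<exists>x\<in>cball 0 1. blinfun_apply f x > norm f - \<delta>" if "\<delta> > 0" for f :: "'a \<Rightarrow>\<^sub>L real" and \<delta>
    using norm_blinfun_le_cball[of f "norm f - \<delta>"] that by force
  then show ?thesis unfolding slice_of_def SUP_cball_blinfun by blast
qed

text \<open>Otherwise every \<open>S n\<close> has a point in the closed half-space
  \<open>f \<le> a\<close>. That half-space then contains the closed convex hull of these points,
  hence the ball, which forces \<open>norm f \<le> a\<close>.\<close>

lemma determining_slices_refine_slice:
  fixes f :: "'a::real_normed_vector \<Rightarrow>\<^sub>L real"
  assumes det: "\<forall>b. (\<forall>n. b n \<in> S n) \<longrightarrow> cball 0 1 \<subseteq> closure (convex hull (range b))"
    and a: "a < norm f"
  obtains n :: nat where "\<And>x. x \<in> S n \<Longrightarrow> a < f x"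
proof -
  have False if *: "\<And>n. \<exists>x\<in>S n. f x \<le> a"
  proof -
    obtain b where b: "\<And>n. b n \<in> S n" "\<And>n. f (b n) \<le> a" using * by metis
    have "convex {x. f x \<le> a}"
      by (rule convexI) (auto simp: blinfun.bilinear_simps intro: convex_bound_le)
    moreover have "closed {x. f x \<le> a}"
      by (intro closed_Collect_le continuous_intros)
    ultimately have "closure (convex hull (range b)) \<subseteq> {x. f x \<le> a}"
      using b(2) by (intro closure_minimal hull_minimal) auto
    then have "norm f \<le> a" using det b(1) by (intro norm_blinfun_le_cball) blast
    with a show False by simp
  qed
  then show thesis using that by (meson not_le)
qed

section \<open>Slices and ball coverings of the dual sphere\<close>

text \<open>If the slice of width \<open>\<delta>\<close> given by \<open>g\<close> lies in \<open>{f > \<beta>}\<close>, then every multiple \<open>t g\<close> with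
  \<open>t \<delta> \<ge> 2\<close> is so long that outside the slice the loss \<open>t \<delta>\<close> outweighs the values of \<open>f\<close>.\<close>

lemma slice_subset_imp_dist_le:
  fixes f g :: "'a::real_normed_vector \<Rightarrow>\<^sub>L real"
  assumes sub: "\<And>x. x \<in> cball 0 1 \<Longrightarrow> norm g - \<delta> < g x \<Longrightarrow> \<beta> < f x"
    and "norm f \<le> 1" "\<beta> \<le> 1" "0 \<le> t" "2 \<le> t * \<delta>"
  shows "dist (t *\<^sub>R g) f \<le> norm (t *\<^sub>R g) - \<beta>"
  unfolding dist_norm
proof (rule norm_blinfun_le_cball)
  fix x :: 'a
  assume x: "x \<in> cball 0 1"
  show "(t *\<^sub>R g - f) x \<le> norm (t *\<^sub>R g) - \<beta>"
  proof (cases "norm g - \<delta> < g x")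
    case True
    have "t * g x \<le> t * norm g" using blinfun_le_norm[OF x] assms by (intro mult_left_mono)
    then show ?thesis using sub[OF x True] assms by (simp add: blinfun.bilinear_simps)
  next
    case False
    then have "t * g x \<le> t * (norm g - \<delta>)" using assms by (intro mult_left_mono) auto
    moreover have "- f x \<le> 1"
      using blinfun_le_norm[of "- x" f] x assms by (simp add: blinfun.bilinear_simps)
    ultimately show ?thesis using assms by (simp add: blinfun.bilinear_simps algebra_simps)
  qed
qed

lemma scd_cball_imp_alpha_bcp:
  assumes scd: "scd_set (cball (0 :: 'a::real_normed_vector) 1)" and "\<alpha> < 1"
  shows "alpha_bcp TYPE('a \<Rightarrow>\<^sub>L real) \<alpha>"
proof -
  obtain S :: "nat \<Rightarrow> 'a set" where S: "\<forall>n. slice_of (cball (0 :: 'a) 1) (S n)"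
    and det: "\<forall>b. (\<forall>n. b n \<in> S n) \<longrightarrow> cball 0 1 \<subseteq> closure (convex hull (range b))"
    using scd unfolding scd_set_def by blast
  obtain g :: "nat \<Rightarrow> 'a \<Rightarrow>\<^sub>L real" and \<delta> where \<delta>: "\<And>n. \<delta> n > 0"
    and S_eq: "\<And>n. S n = {x \<in> cball 0 1. blinfun_apply (g n) x > norm (g n) - \<delta> n}"
    using S unfolding slice_of_cball_iff by metis
  define z where "z n = (2 / \<delta> n) *\<^sub>R g n" for n
  \<comment> \<open>Radii are as large as the covering condition permits; pairs with non-positive
    radius, whose balls are empty, are dropped.\<close>
  define C where "C = {(z', r) \<in> range (\<lambda>n. (z n, norm (z n) - \<alpha>)). r > 0}"
  have "f \<in> (\<Union>(z, r)\<in>C. ball z r)" if f: "norm f = 1" for f :: "'a \<Rightarrow>\<^sub>L real"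
  proof -
    \<comment> \<open>The gap between \<open>\<alpha>\<close> and \<open>\<beta>\<close> turns the
      weak distance estimate into membership in an open ball.\<close>
    obtain \<beta> where \<beta>: "\<alpha> < \<beta>" "\<beta> < 1" using dense[OF \<open>\<alpha> < 1\<close>] by blast
    obtain n where n: "\<And>x. x \<in> S n \<Longrightarrow> \<beta> < f x"
      using determining_slices_refine_slice[OF det, of \<beta> f] \<beta> f by auto
    have "dist (z n) f \<le> norm (z n) - \<beta>"
      unfolding z_def using n \<delta>[of n] f \<beta> by (intro slice_subset_imp_dist_le) (auto simp: S_eq)
    then have "dist (z n) f < norm (z n) - \<alpha>" using \<beta> by simp
    moreover have "0 < norm (z n) - \<alpha>" using calculation zero_le_dist[of "z n" f] by linarith
    ultimately show ?thesis by (intro UN_I[of "(z n, norm (z n) - \<alpha>)"]) (auto simp: C_def)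
  qed
  moreover have "countable C"
    unfolding C_def by (rule countable_subset[of _ "range (\<lambda>n. (z n, norm (z n) - \<alpha>))"]) auto
  ultimately show ?thesis
    unfolding alpha_bcp_def by (intro exI[of _ C]) (auto simp: C_def)
qed

text \<open>If the hull of a selection misses a point of the ball, separation gives a norm-one
  \<open>g\<close> that stays below \<open>1 - e\<close> on the selection. A ball of
  \<open>C k\<close> around \<open>z\<close> that contains \<open>g\<close> contradicts this at the
  point selected from the slice of \<open>z\<close>.\<close>

lemma alpha_bcp_imp_scd_cball:
  assumes bcp: "\<And>\<beta>. \<beta> < 1 \<Longrightarrow> \<exists>\<alpha>>\<beta>. alpha_bcp TYPE('a::real_normed_vector \<Rightarrow>\<^sub>L real) \<alpha>"
  shows "scd_set (cball (0 :: 'a) 1)"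
proof -
  define \<epsilon> where "\<epsilon> k = 1 / real (Suc k)" for k
  have \<epsilon>: "0 < \<epsilon> k" for k by (simp add: \<epsilon>_def)
  have "\<exists>C :: (('a \<Rightarrow>\<^sub>L real) \<times> real) set. countable C \<and>
      (\<forall>(z, r)\<in>C. norm z > r + (1 - \<epsilon> k)) \<and> sphere 0 1 \<subseteq> (\<Union>(z, r)\<in>C. ball z r)" for k
    using bcp[of "1 - \<epsilon> k"] \<epsilon>[of k] unfolding alpha_bcp_def by fastforce
  then obtain C :: "nat \<Rightarrow> (('a \<Rightarrow>\<^sub>L real) \<times> real) set" where countable: "\<And>k. countable (C k)"
    and off: "\<And>k z r. (z, r) \<in> C k \<Longrightarrow> norm z > r + (1 - \<epsilon> k)"
    and cover: "\<And>k. sphere 0 1 \<subseteq> (\<Union>(z, r)\<in>C k. ball z r)"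
    by (simp add: choice_iff split_beta) (metis fst_conv snd_conv)
  define sl where "sl k z = {x \<in> cball 0 1. blinfun_apply z x > norm z - \<epsilon> k}"
    for k and z :: "'a \<Rightarrow>\<^sub>L real"
  \<comment> \<open>The slice given by \<open>0\<close> is added because all \<open>C k\<close> are empty in the zero space.\<close>
  define \<S> where "\<S> = insert (sl 0 0) (\<Union>k. sl k ` fst ` C k)"
  define S where "S = from_nat_into \<S>"
  have range_S: "range S = \<S>"
    unfolding S_def by (rule range_from_nat_into) (auto simp: \<S>_def countable)
  have "slice_of (cball 0 1) (sl k z)" for k z
    unfolding slice_of_cball_iff sl_def using \<epsilon> by blast
  then have "slice_of (cball 0 1) (S n)" for n
    using range_S unfolding \<S>_def by (metis (no_types, lifting) UN_E imageE insertE rangeI)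
  moreover have "cball 0 1 \<subseteq> closure (convex hull (range b))" if b: "\<And>n. b n \<in> S n" for b
  proof (rule ccontr)
    assume "\<not> cball 0 1 \<subseteq> closure (convex hull (range b))"
    then obtain x where x: "x \<in> cball 0 1" "x \<notin> closure (convex hull (range b))" by blast
    have "closure (convex hull (range b)) \<noteq> {}" by simp
    then obtain f :: "'a \<Rightarrow>\<^sub>L real" and d where d: "0 < d"
      and f: "\<And>k. k \<in> closure (convex hull (range b)) \<Longrightarrow> f k \<le> f x - d"
      by (rule separate_point_closed_convex
          [OF convex_closure[OF convex_convex_hull] closed_closure _ x(2)]) (rule that)
    have fb: "f (b n) \<le> norm f - d" for n
    proof -
      have "b n \<in> closure (convex hull (range b))"
        by (intro subsetD[OF closure_subset] hull_inc rangeI)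
      from f[OF this] show ?thesis using blinfun_le_norm[OF x(1), of f] by simp
    qed
    have "f \<noteq> 0" using fb[of 0] d by auto
    then have "norm f > 0" by simp
    define g where "g = f /\<^sub>R norm f"
    have g: "norm g = 1" using \<open>f \<noteq> 0\<close> by (simp add: g_def)
    define e where "e = d / norm f"
    have gb: "g (b n) \<le> 1 - e" for n
      using fb[of n] \<open>norm f > 0\<close> by (simp add: g_def e_def blinfun.bilinear_simps field_simps)
    have "0 < e / 2" using d \<open>norm f > 0\<close> by (simp add: e_def)
    \<comment> \<open>Half of \<open>e\<close>, since \<open>\<epsilon> k\<close> is lost twice: in
      the offset of the ball and in the width of the slice.\<close>
    then obtain k where k: "\<epsilon> k < e / 2"
      unfolding \<epsilon>_def by (metis nat_approx_posE)
    obtain z r where zr: "(z, r) \<in> C k" "dist z g < r"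
      using cover[of k] g by (force simp: subset_iff)
    then have "sl k z \<in> range S" unfolding range_S \<S>_def by force
    then obtain n where "b n \<in> sl k z" using b by (metis rangeE)
    then have bn: "b n \<in> cball 0 1" "z (b n) > norm z - \<epsilon> k" by (auto simp: sl_def)
    have "z (b n) - g (b n) \<le> dist z g"
      using blinfun_le_norm[OF bn(1), of "z - g"] by (simp add: dist_norm blinfun.bilinear_simps)
    then show False using bn(2) zr(2) off[OF zr(1)] gb[of n] k by linarith
  qed
  ultimately show ?thesis unfolding scd_set_def by (intro conjI exI[of _ S]) auto
qed

text \<open>The value \<open>- 1\<close> for the empty set differs from 1, so index 1 means that the
  admissible values approach 1.\<close>

lemma ball_covering_index_eq_1_iff:
  "ball_covering_index TYPE('z::banach) = 1 \<longleftrightarrow>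
    (\<forall>\<beta><1. \<exists>\<alpha>. \<beta> < \<alpha> \<and> \<alpha> < 1 \<and> alpha_bcp TYPE('z) \<alpha>)"
proof -
  define A where "A = {\<alpha> \<in> {-1..<1}. alpha_bcp TYPE('z) \<alpha>}"
  have bdd: "bdd_above A" by (rule bdd_aboveI[of _ 1]) (auto simp: A_def)
  have "ball_covering_index TYPE('z) = 1 \<longleftrightarrow> A \<noteq> {} \<and> Sup A = 1"
    by (simp add: ball_covering_index_def A_def)
  also have "\<dots> \<longleftrightarrow> (\<forall>\<beta><1. \<exists>\<alpha>\<in>A. \<beta> < \<alpha>)"
  proof
    assume "A \<noteq> {} \<and> Sup A = 1"
    then show "\<forall>\<beta><1. \<exists>\<alpha>\<in>A. \<beta> < \<alpha>" using less_cSup_iff[OF _ bdd] by auto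
  next
    assume *: "\<forall>\<beta><1. \<exists>\<alpha>\<in>A. \<beta> < \<alpha>"
    then have "A \<noteq> {}" by (metis empty_iff zero_less_one)
    moreover have "Sup A \<le> 1" using calculation by (intro cSup_least) (auto simp: A_def)
    moreover have "\<not> Sup A < 1"
      using * cSup_upper[OF _ bdd] by (metis not_le)
    ultimately show "A \<noteq> {} \<and> Sup A = 1" by simp
  qed
  also have "\<dots> \<longleftrightarrow> (\<forall>\<beta><1. \<exists>\<alpha>. \<beta> < \<alpha> \<and> \<alpha> < 1 \<and> alpha_bcp TYPE('z) \<alpha>)"
  proof
    assume "\<forall>\<beta><1. \<exists>\<alpha>\<in>A. \<beta> < \<alpha>"
    then show "\<forall>\<beta><1. \<exists>\<alpha>. \<beta> < \<alpha> \<and> \<alpha> < 1 \<and> alpha_bcp TYPE('z) \<alpha>" by (auto simp: A_def)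
  next
    assume *: "\<forall>\<beta><1. \<exists>\<alpha>. \<beta> < \<alpha> \<and> \<alpha> < 1 \<and> alpha_bcp TYPE('z) \<alpha>"
    show "\<forall>\<beta><1. \<exists>\<alpha>\<in>A. \<beta> < \<alpha>"
    proof (intro allI impI)
      fix \<beta> :: real
      assume "\<beta> < 1"
      then obtain \<alpha> where "max \<beta> (-1) < \<alpha>" "\<alpha> < 1" "alpha_bcp TYPE('z) \<alpha>"
        using *[rule_format, of "max \<beta> (-1)"] by auto
      then show "\<exists>\<alpha>\<in>A. \<beta> < \<alpha>" by (intro bexI[of _ \<alpha>]) (auto simp: A_def)
    qed
  qed
  finally show ?thesis .
qed

theorem theoremA:
  assumes "separable_space (euclidean :: 'a::banach topology)"
  shows "scd_set (cball (0 :: 'a) 1) \<longleftrightarrow>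
         ball_covering_index TYPE('a \<Rightarrow>\<^sub>L real) = 1"
  unfolding ball_covering_index_eq_1_iff
proof
  assume "scd_set (cball (0 :: 'a) 1)"
  then show "\<forall>\<beta><1. \<exists>\<alpha>. \<beta> < \<alpha> \<and> \<alpha> < 1 \<and> alpha_bcp TYPE('a \<Rightarrow>\<^sub>L real) \<alpha>"
    by (meson dense scd_cball_imp_alpha_bcp)
next
  assume "\<forall>\<beta><1. \<exists>\<alpha>. \<beta> < \<alpha> \<and> \<alpha> < 1 \<and> alpha_bcp TYPE('a \<Rightarrow>\<^sub>L real) \<alpha>"
  then show "scd_set (cball (0 :: 'a) 1)" by (intro alpha_bcp_imp_scd_cball) blast
qed

end
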